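(* Let $s_0, s_f, v_0, v_f \in \mathbb{R}$, and let \[ \mathcal{A} := \Big\{u\in L^2(0,1;\mathbb{R}) \;:\; \exists\, x=(x_1,x_2)\in W^{1,2}(0,1;\mathbb{R}^2) \text{ with } \dot{x}_1(t) = x_2(t),\ \dot{x}_2(t) = u(t) \text{ for a.e. } t\in[0,1],\ x_1(0)=s_0,\ x_1(1)=s_f,\ x_2(0)=v_0,\ x_2(1)=v_f\Big\}. \] Let $u^-\in L^2(0,1;\mathbb{R})$, and let $x=(x_1,x_2)$ be the solution of the initial value problem \[ \dot{x}_1(t) = x_2(t),\quad x_1(0)=s_0,\qquad \dot{x}_2(t) = u^-(t),\quad x_2(0)=v_0,\qquad t\in[0,1]. \] Set \[ c_1 = 12\,(x_1(1)-s_f) - 6\,(x_2(1)-v_f),\qquad c_2 = -6\,(x_1(1)-s_f) + 2\,(x_2(1)-v_f). \] Then the projection $P_{\mathcal{A}}(u^-)$ of $u^-$ onto $\mathcal{A}$, i.e. the solution of the problem \[ \min\ \frac{1}{2}\int_0^1 (u(t)-u^-(t))^2\,dt \quad\text{subject to}\quad u\in\mathcal{A}, \] is given by \[ P_{\mathcal{A}}(u^-)(t) = u^-(t) + c_1\,t + c_2 \qquad\text{for all } t\in[0,1]. \]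
   Context: $L^2(0,1;\mathbb{R}^q)$ denotes the Hilbert space of (equivalence classes of) Lebesgue measurable functions $z:[0,1]\to\mathbb{R}^q$ with $\|z\|_2=\big(\sum_{i=1}^q\int_0^1 |z_i(t)|^2\,dt\big)^{1/2}<\infty$, and $W^{1,2}(0,1;\mathbb{R}^q)$ is the Sobolev space of absolutely continuous functions $z\in L^2(0,1;\mathbb{R}^q)$ with $\dot z\in L^2(0,1;\mathbb{R}^q)$. The projection is taken with respect to the $L^2$ norm. *)

theory Defs
  imports "HOL-Analysis.Analysis"
begin

text \<open>Square integrable real functions on [0,1] (representatives of L^2(0,1;R)).\<close>
definition L2_01 :: "(real \<Rightarrow> real) \<Rightarrow> bool" where
  "L2_01 f \<longleftrightarrow> f \<in> borel_measurable (lebesgue_on {0..1})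
      \<and> integrable (lebesgue_on {0..1}) (\<lambda>t. (f t)\<^sup>2)"

text \<open>Absolute continuity on [0,1]: for every eps > 0 there is delta > 0 such that for every
  finite family of non-overlapping subintervals [a i, b i] of [0,1] (listed in increasing order)
  of total length < delta, the total variation of f over them is < eps.\<close>
definition abs_cont_01 :: "(real \<Rightarrow> real) \<Rightarrow> bool" where
  "abs_cont_01 f \<longleftrightarrow> (\<forall>\<epsilon>>0. \<exists>\<delta>>0. \<forall>(n::nat) (a::nat \<Rightarrow> real) b.
      (\<forall>i<n. 0 \<le> a i \<and> a i \<le> b i \<and> b i \<le> 1) \<and>
      (\<forall>i j. i < j \<and> j < n \<longrightarrow> b i \<le> a j) \<and>
      (\<Sum>i<n. b i - a i) < \<delta>
      \<longrightarrow> (\<Sum>i<n. \<bar>f (b i) - f (a i)\<bar>) < \<epsilon>)"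

text \<open>The Sobolev space W^{1,2}(0,1;R): absolutely continuous L^2 functions whose
  (a.e. existing) derivative lies in L^2.\<close>
definition W12_01 :: "(real \<Rightarrow> real) \<Rightarrow> bool" where
  "W12_01 f \<longleftrightarrow> L2_01 f \<and> abs_cont_01 f \<and>
     (\<exists>g. L2_01 g \<and> (AE t in lebesgue_on {0..1}. (f has_real_derivative g t) (at t)))"

text \<open>The admissible set \<A>.\<close>
definition admissible :: "real \<Rightarrow> real \<Rightarrow> real \<Rightarrow> real \<Rightarrow> (real \<Rightarrow> real) set" where
  "admissible s0 sf v0 vf = {u. L2_01 u \<and> (\<exists>x1 x2. W12_01 x1 \<and> W12_01 x2 \<and>
      (AE t in lebesgue_on {0..1}. (x1 has_real_derivative x2 t) (at t)
                                 \<and> (x2 has_real_derivative u t) (at t)) \<and>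
      x1 0 = s0 \<and> x1 1 = sf \<and> x2 0 = v0 \<and> x2 1 = vf)}"

text \<open>p is the (L^2-)projection of f onto A: p is in A, minimises (1/2)||u - f||^2 over A,
  and every other minimiser coincides with p almost everywhere (i.e. as element of L^2).\<close>
definition is_L2_projection :: "(real \<Rightarrow> real) set \<Rightarrow> (real \<Rightarrow> real) \<Rightarrow> (real \<Rightarrow> real) \<Rightarrow> bool" where
  "is_L2_projection A f p \<longleftrightarrow> p \<in> A \<and>
     (\<forall>u\<in>A. (1/2) * integral\<^sup>L (lebesgue_on {0..1}) (\<lambda>t. (p t - f t)\<^sup>2)
            \<le> (1/2) * integral\<^sup>L (lebesgue_on {0..1}) (\<lambda>t. (u t - f t)\<^sup>2)) \<and>
     (\<forall>u\<in>A. (1/2) * integral\<^sup>L (lebesgue_on {0..1}) (\<lambda>t. (u t - f t)\<^sup>2)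
            \<le> (1/2) * integral\<^sup>L (lebesgue_on {0..1}) (\<lambda>t. (p t - f t)\<^sup>2)
            \<longrightarrow> (AE t in lebesgue_on {0..1}. u t = p t))"

end

(*
  Every admissible control u has the same two moments as any other: integrating the state
  equations (x2' = u, and (x1 - t x2)' = - t u) gives int u = vf - v0 and int t u = s0 + vf - sf.
  The candidate p = u^- + c1 t + c2 is admissible, since its state is x plus a cubic correction,
  and c1, c2 are exactly the coefficients for which this correction reaches the terminal
  conditions. Hence u - p is L^2-orthogonal to 1 and t, whereas p - u^- is a combination of them,
  and Pythagoras gives ||u - u^-||^2 = ||u - p||^2 + ||p - u^-||^2, i.e. minimality and uniqueness.

  The analytic ingredient is the fundamental theorem of calculus for an absolutely continuous f
  whose a.e. derivative g is integrable. Approximate g in L^1 by a continuous p and put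
  h = f - int_0^t p. As h is absolutely continuous it maps null sets to null sets (Luzin's
  property N), and on the set where h' = g - p the measure of its image is at most int |g - p|.
  Since h([0,1]) contains the interval between h 0 and h 1, |h 1 - h 0| <= int |g - p|.
*)

theory Submission
  imports Defs
begin

section \<open>Absolutely continuous functions on the unit interval\<close>

definition ordered_subintervals_01 :: "nat \<Rightarrow> (nat \<Rightarrow> real) \<Rightarrow> (nat \<Rightarrow> real) \<Rightarrow> bool" where
  "ordered_subintervals_01 n a b \<longleftrightarrow>
     (\<forall>i<n. 0 \<le> a i \<and> a i \<le> b i \<and> b i \<le> 1) \<and> (\<forall>i j. i < j \<and> j < n \<longrightarrow> b i \<le> a j)"

lemma abs_cont_01_iff:
  "abs_cont_01 f \<longleftrightarrow> (\<forall>e>0. \<exists>d>0. \<forall>n a b. ordered_subintervals_01 n a b \<longrightarrow>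
      (\<Sum>i<n. b i - a i) < d \<longrightarrow> (\<Sum>i<n. \<bar>f (b i) - f (a i)\<bar>) < e)"
  unfolding abs_cont_01_def ordered_subintervals_01_def by (simp add: imp_conjL)

lemma abs_cont_01I:
  assumes "\<And>e. e > 0 \<Longrightarrow> \<exists>d>0. \<forall>n a b. ordered_subintervals_01 n a b \<longrightarrow>
      (\<Sum>i<n. b i - a i) < d \<longrightarrow> (\<Sum>i<n. \<bar>f (b i) - f (a i)\<bar>) < e"
  shows "abs_cont_01 f"
  using assms unfolding abs_cont_01_iff by blast

lemma abs_cont_01E:
  assumes "abs_cont_01 f" "e > 0"
  obtains d where "d > 0" "\<And>n a b. ordered_subintervals_01 n a b \<Longrightarrow>
      (\<Sum>i<n. b i - a i) < d \<Longrightarrow> (\<Sum>i<n. \<bar>f (b i) - f (a i)\<bar>) < e"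
  using assms unfolding abs_cont_01_iff by meson

lemma abs_cont_01_imp_continuous_on:
  assumes "abs_cont_01 f"
  shows "continuous_on {0..1} f"
  unfolding continuous_on_iff
proof (intro ballI allI impI)
  fix x e :: real
  assume x: "x \<in> {0..1}" and "e > 0"
  obtain d where "d > 0" and small: "\<And>n a b. ordered_subintervals_01 n a b \<Longrightarrow>
      (\<Sum>i<n. b i - a i) < d \<Longrightarrow> (\<Sum>i<n. \<bar>f (b i) - f (a i)\<bar>) < e"
    using abs_cont_01E[OF assms \<open>e > 0\<close>] by blast
  have "dist (f y) (f x) < e" if y: "y \<in> {0..1}" "dist y x < d" for y
  proof -
    have "\<bar>f (max x y) - f (min x y)\<bar> < e"
      using small[of 1 "\<lambda>_. min x y" "\<lambda>_. max x y"] x y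
      by (auto simp: ordered_subintervals_01_def dist_real_def)
    then show ?thesis
      by (auto simp: dist_real_def max_def min_def abs_minus_commute split: if_splits)
  qed
  with \<open>d > 0\<close> show "\<exists>d>0. \<forall>y\<in>{0..1}. dist y x < d \<longrightarrow> dist (f y) (f x) < e"
    by blast
qed

lemma lipschitz_on_imp_abs_cont_01:
  assumes lip: "L-lipschitz_on {0..1} f"
  shows "abs_cont_01 f"
proof (rule abs_cont_01I)
  fix e :: real
  assume "e > 0"
  have "L \<ge> 0" using lipschitz_on_nonneg[OF lip] .
  have "(\<Sum>i<n. \<bar>f (b i) - f (a i)\<bar>) < e"
    if ab: "ordered_subintervals_01 n a b" and small: "(\<Sum>i<n. b i - a i) < e / (L + 1)" for n a b
  proof -
    have "(\<Sum>i<n. \<bar>f (b i) - f (a i)\<bar>) \<le> (\<Sum>i<n. L * (b i - a i))"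
    proof (rule sum_mono)
      fix i
      assume "i \<in> {..<n}"
      then have "a i \<in> {0..1}" "b i \<in> {0..1}" "a i \<le> b i"
        using ab by (auto simp: ordered_subintervals_01_def)
      then show "\<bar>f (b i) - f (a i)\<bar> \<le> L * (b i - a i)"
        using lipschitz_onD[OF lip, of "b i" "a i"] by (simp add: dist_real_def)
    qed
    also have "\<dots> = L * (\<Sum>i<n. b i - a i)"
      by (simp add: sum_distrib_left)
    also have "\<dots> \<le> L * (e / (L + 1))"
      using small \<open>L \<ge> 0\<close> by (intro mult_left_mono) auto
    also have "\<dots> < e"
      using \<open>L \<ge> 0\<close> \<open>e > 0\<close> by (simp add: field_simps)
    finally show ?thesis .
  qed
  then show "\<exists>d>0. \<forall>n a b. ordered_subintervals_01 n a b \<longrightarrow>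
      (\<Sum>i<n. b i - a i) < d \<longrightarrow> (\<Sum>i<n. \<bar>f (b i) - f (a i)\<bar>) < e"
    using \<open>e > 0\<close> \<open>L \<ge> 0\<close> by (intro exI[of _ "e / (L + 1)"]) auto
qed

lemma abs_cont_01_const: "abs_cont_01 (\<lambda>t. c)"
  by (rule lipschitz_on_imp_abs_cont_01[OF lipschitz_on_constant])

lemma abs_cont_01_ident: "abs_cont_01 (\<lambda>t. t)"
  by (rule lipschitz_on_imp_abs_cont_01[OF lipschitz_on_id])

lemma abs_cont_01_dominated:
  assumes f: "abs_cont_01 f" and g: "abs_cont_01 g" and "A \<ge> 0" "B \<ge> 0"
    and dom: "\<And>x y. x \<in> {0..1} \<Longrightarrow> y \<in> {0..1} \<Longrightarrow>
      \<bar>F y - F x\<bar> \<le> A * \<bar>f y - f x\<bar> + B * \<bar>g y - g x\<bar>"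
  shows "abs_cont_01 F"
proof (rule abs_cont_01I)
  fix e :: real
  assume "e > 0"
  obtain d1 where "d1 > 0" and f_small: "\<And>n a b. ordered_subintervals_01 n a b \<Longrightarrow>
      (\<Sum>i<n. b i - a i) < d1 \<Longrightarrow> (\<Sum>i<n. \<bar>f (b i) - f (a i)\<bar>) < e / (2 * (A + 1))"
    using abs_cont_01E[OF f, of "e / (2 * (A + 1))"] \<open>e > 0\<close> \<open>A \<ge> 0\<close> by auto
  obtain d2 where "d2 > 0" and g_small: "\<And>n a b. ordered_subintervals_01 n a b \<Longrightarrow>
      (\<Sum>i<n. b i - a i) < d2 \<Longrightarrow> (\<Sum>i<n. \<bar>g (b i) - g (a i)\<bar>) < e / (2 * (B + 1))"
    using abs_cont_01E[OF g, of "e / (2 * (B + 1))"] \<open>e > 0\<close> \<open>B \<ge> 0\<close> by auto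
  have half: "C * (e / (2 * (C + 1))) < e / 2" if "C \<ge> 0" for C
    using that \<open>e > 0\<close> by (simp add: field_simps)
  have "(\<Sum>i<n. \<bar>F (b i) - F (a i)\<bar>) < e"
    if ab: "ordered_subintervals_01 n a b" and small: "(\<Sum>i<n. b i - a i) < min d1 d2" for n a b
  proof -
    have "(\<Sum>i<n. \<bar>F (b i) - F (a i)\<bar>)
        \<le> A * (\<Sum>i<n. \<bar>f (b i) - f (a i)\<bar>) + B * (\<Sum>i<n. \<bar>g (b i) - g (a i)\<bar>)"
      unfolding sum_distrib_left sum.distrib[symmetric]
      using ab by (intro sum_mono dom) (auto simp: ordered_subintervals_01_def)
    also have "\<dots> \<le> A * (e / (2 * (A + 1))) + B * (e / (2 * (B + 1)))"
      using f_small[OF ab] g_small[OF ab] small \<open>A \<ge> 0\<close> \<open>B \<ge> 0\<close>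
      by (intro add_mono mult_left_mono) auto
    also have "\<dots> < e / 2 + e / 2"
      using half \<open>A \<ge> 0\<close> \<open>B \<ge> 0\<close> by (intro add_strict_mono) auto
    finally show ?thesis by simp
  qed
  then show "\<exists>d>0. \<forall>n a b. ordered_subintervals_01 n a b \<longrightarrow>
      (\<Sum>i<n. b i - a i) < d \<longrightarrow> (\<Sum>i<n. \<bar>F (b i) - F (a i)\<bar>) < e"
    using \<open>d1 > 0\<close> \<open>d2 > 0\<close> by (intro exI[of _ "min d1 d2"]) auto
qed

lemma abs_cont_01_add:
  assumes "abs_cont_01 f" "abs_cont_01 g"
  shows "abs_cont_01 (\<lambda>t. f t + g t)"
  by (rule abs_cont_01_dominated[OF assms, of 1 1]) auto

lemma abs_cont_01_diff:
  assumes "abs_cont_01 f" "abs_cont_01 g"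
  shows "abs_cont_01 (\<lambda>t. f t - g t)"
  by (rule abs_cont_01_dominated[OF assms, of 1 1]) auto

lemma abs_cont_01_mult:
  assumes f: "abs_cont_01 f" and g: "abs_cont_01 g"
  shows "abs_cont_01 (\<lambda>t. f t * g t)"
proof -
  obtain A where "A \<ge> 0" and A: "\<And>t. t \<in> {0..1} \<Longrightarrow> \<bar>f t\<bar> \<le> A"
    using continuous_on_compact_bound[OF compact_Icc abs_cont_01_imp_continuous_on[OF f]]
    by (metis real_norm_def)
  obtain B where "B \<ge> 0" and B: "\<And>t. t \<in> {0..1} \<Longrightarrow> \<bar>g t\<bar> \<le> B"
    using continuous_on_compact_bound[OF compact_Icc abs_cont_01_imp_continuous_on[OF g]]
    by (metis real_norm_def)
  show ?thesis
  proof (rule abs_cont_01_dominated[OF g f \<open>A \<ge> 0\<close> \<open>B \<ge> 0\<close>])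
    fix x y :: real
    assume "x \<in> {0..1}" "y \<in> {0..1}"
    have "f y * g y - f x * g x = f y * (g y - g x) + g x * (f y - f x)"
      by (simp add: algebra_simps)
    also have "\<bar>\<dots>\<bar> \<le> \<bar>f y\<bar> * \<bar>g y - g x\<bar> + \<bar>g x\<bar> * \<bar>f y - f x\<bar>"
      by (metis abs_mult abs_triangle_ineq)
    also have "\<dots> \<le> A * \<bar>g y - g x\<bar> + B * \<bar>f y - f x\<bar>"
      using A[OF \<open>y \<in> {0..1}\<close>] B[OF \<open>x \<in> {0..1}\<close>] by (intro add_mono mult_right_mono) auto
    finally show "\<bar>f y * g y - f x * g x\<bar> \<le> A * \<bar>g y - g x\<bar> + B * \<bar>f y - f x\<bar>" .
  qed
qed

lemma abs_cont_01_integral_continuous: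
  assumes "continuous_on {0..1} p"
  shows "abs_cont_01 (\<lambda>t. integral {0..t} p)"
proof -
  obtain B where "B \<ge> 0" and B: "\<And>t. t \<in> {0..1} \<Longrightarrow> \<bar>p t\<bar> \<le> B"
    using continuous_on_compact_bound[OF compact_Icc assms] by (metis real_norm_def)
  have "B-lipschitz_on {0..1} (\<lambda>t. integral {0..t} p)"
  proof (rule lipschitz_on_leI)
    fix x y :: real
    assume "x \<in> {0..1}" "y \<in> {0..1}" "x \<le> y"
    then have "integral {0..y} p - integral {0..x} p = integral {x..y} p"
      using Henstock_Kurzweil_Integration.integral_combine[of 0 x y p]
        integrable_continuous_real[OF continuous_on_subset[OF assms]] by auto
    moreover have "p integrable_on cbox x y"
      using \<open>x \<in> {0..1}\<close> \<open>y \<in> {0..1}\<close>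
      by (intro integrable_continuous continuous_on_subset[OF assms]) auto
    then have "norm (integral (cbox x y) p) \<le> B * Henstock_Kurzweil_Integration.content (cbox x y)"
      using \<open>x \<in> {0..1}\<close> \<open>y \<in> {0..1}\<close> B
      by (intro integrable_bound[OF \<open>B \<ge> 0\<close>]) auto
    ultimately show "dist (integral {0..x} p) (integral {0..y} p) \<le> B * dist x y"
      using \<open>x \<le> y\<close> by (simp add: dist_real_def abs_minus_commute)
  qed (rule \<open>B \<ge> 0\<close>)
  then show ?thesis
    by (rule lipschitz_on_imp_abs_cont_01)
qed

section \<open>Luzin's property N\<close>

lemma disjoint_open_intervals_separated:
  fixes a b c d :: "'a::dense_linorder"
  assumes "{a<..<b} \<inter> {c<..<d} = {}" "a < b" "c < d"
  shows "b \<le> c \<or> d \<le> a"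
proof (rule ccontr)
  assume "\<not> (b \<le> c \<or> d \<le> a)"
  then have "max a c < min b d"
    using assms(2,3) by auto
  then obtain z where "max a c < z" "z < min b d"
    using dense by blast
  then have "z \<in> {a<..<b} \<inter> {c<..<d}"
    by auto
  with assms(1) show False
    by blast
qed

lemma finite_enumerate_increasing:
  fixes a :: "'i \<Rightarrow> 'b::linorder"
  assumes "finite J" "inj_on a J"
  obtains \<sigma> where "bij_betw \<sigma> {..<card J} J"
    "\<And>i j. i < j \<Longrightarrow> j < card J \<Longrightarrow> a (\<sigma> i) < a (\<sigma> j)"
proof -
  define xs where "xs = sorted_list_of_set (a ` J)"
  have len: "length xs = card J"
    using card_image[OF assms(2)] by (simp add: xs_def)
  have "bij_betw ((!) xs) {..<card J} (a ` J)"
    by (rule bij_betw_nth) (use assms(1) len in \<open>simp_all add: xs_def\<close>)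
  moreover have "bij_betw (inv_into J a) (a ` J) J"
    by (rule bij_betw_inv_into[OF inj_on_imp_bij_betw[OF assms(2)]])
  ultimately have bij: "bij_betw (inv_into J a \<circ> (!) xs) {..<card J} J"
    by (rule bij_betw_trans)
  have "a ((inv_into J a \<circ> (!) xs) i) < a ((inv_into J a \<circ> (!) xs) j)"
    if "i < j" "j < card J" for i j
  proof -
    have "set xs = a ` J"
      using assms(1) by (simp add: xs_def)
    then have "xs ! i \<in> a ` J" "xs ! j \<in> a ` J"
      using that len nth_mem[of i xs] nth_mem[of j xs] by auto
    moreover have "sorted_wrt (<) xs"
      by (simp add: xs_def strict_sorted_iff)
    then have "xs ! i < xs ! j"
      using that len by (simp add: sorted_wrt_nth_less)
    ultimately show ?thesis
      by (simp add: f_inv_into_f)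
  qed
  with bij show ?thesis
    using that by blast
qed

lemma disjoint_open_intervals_enumerate_ordered:
  assumes "finite J" and ab: "\<forall>i\<in>J. 0 \<le> a i \<and> a i < b i \<and> b i \<le> 1"
    and disj: "disjoint_family_on (\<lambda>i. {a i<..<b i}) J"
  obtains \<sigma> where "bij_betw \<sigma> {..<card J} J" "ordered_subintervals_01 (card J) (a \<circ> \<sigma>) (b \<circ> \<sigma>)"
proof -
  have sep: "b i \<le> a j \<or> b j \<le> a i" if "i \<in> J" "j \<in> J" "i \<noteq> j" for i j
    using disjoint_open_intervals_separated[OF disjoint_family_onD[OF disj that]] ab that by auto
  have "inj_on a J"
  proof (rule inj_onI, rule ccontr)
    fix i j
    assume "i \<in> J" "j \<in> J" "a i = a j" "i \<noteq> j"
    then show False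
      using sep[of i j] ab by force
  qed
  then obtain \<sigma> where bij: "bij_betw \<sigma> {..<card J} J"
    and incr: "\<And>i j. i < j \<Longrightarrow> j < card J \<Longrightarrow> a (\<sigma> i) < a (\<sigma> j)"
    using finite_enumerate_increasing[OF \<open>finite J\<close>] by blast
  have \<sigma>J: "\<sigma> i \<in> J" if "i < card J" for i
    using bij_betwE[OF bij] that by blast
  have ab_\<sigma>: "0 \<le> a (\<sigma> i) \<and> a (\<sigma> i) < b (\<sigma> i) \<and> b (\<sigma> i) \<le> 1" if "i < card J" for i
    using ab \<sigma>J[OF that] by blast
  have "ordered_subintervals_01 (card J) (a \<circ> \<sigma>) (b \<circ> \<sigma>)"
    unfolding ordered_subintervals_01_def
  proof (intro conjI allI impI)
    fix i j
    assume "i < j \<and> j < card J"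
    then have "a (\<sigma> i) < a (\<sigma> j)" "\<sigma> i \<in> J" "\<sigma> j \<in> J"
      using incr \<sigma>J by auto
    moreover from this have "\<sigma> i \<noteq> \<sigma> j"
      by auto
    ultimately show "(b \<circ> \<sigma>) i \<le> (a \<circ> \<sigma>) j"
      using sep[of "\<sigma> i" "\<sigma> j"] ab by force
  qed (auto dest: ab_\<sigma>)
  with bij show ?thesis
    using that by blast
qed

lemma abs_cont_01_disjoint_family:
  assumes "abs_cont_01 f" "e > 0"
  obtains d where "d > 0" "\<And>(I :: 'i set) a b. finite I \<Longrightarrow>
      \<forall>i\<in>I. 0 \<le> a i \<and> a i \<le> b i \<and> b i \<le> 1 \<Longrightarrow> disjoint_family_on (\<lambda>i. {a i<..<b i}) I \<Longrightarrow>
      (\<Sum>i\<in>I. b i - a i) < d \<Longrightarrow> (\<Sum>i\<in>I. \<bar>f (b i) - f (a i)\<bar>) < e"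
proof -
  obtain d where "d > 0" and small: "\<And>n a b. ordered_subintervals_01 n a b \<Longrightarrow>
      (\<Sum>i<n. b i - a i) < d \<Longrightarrow> (\<Sum>i<n. \<bar>f (b i) - f (a i)\<bar>) < e"
    using abs_cont_01E[OF assms] by blast
  have "(\<Sum>i\<in>I. \<bar>f (b i) - f (a i)\<bar>) < e"
    if "finite I" and ab: "\<forall>i\<in>I. 0 \<le> a i \<and> a i \<le> b i \<and> b i \<le> 1"
      and disj: "disjoint_family_on (\<lambda>i. {a i<..<b i}) I" and len: "(\<Sum>i\<in>I. b i - a i) < d"
    for I :: "'i set" and a b
  proof -
    define J where "J = {i\<in>I. a i < b i}"
    have sum_J: "sum g I = sum g J" if zero: "\<And>i. i \<in> I \<Longrightarrow> a i = b i \<Longrightarrow> g i = 0" for g :: "'i \<Rightarrow> real"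
      using \<open>finite I\<close> ab by (intro sum.mono_neutral_right) (auto simp: J_def intro!: zero)
    obtain \<sigma> where bij: "bij_betw \<sigma> {..<card J} J"
      and ordered: "ordered_subintervals_01 (card J) (a \<circ> \<sigma>) (b \<circ> \<sigma>)"
    proof (rule disjoint_open_intervals_enumerate_ordered)
      show "finite J" "\<forall>i\<in>J. 0 \<le> a i \<and> a i < b i \<and> b i \<le> 1"
        using \<open>finite I\<close> ab by (auto simp: J_def)
      show "disjoint_family_on (\<lambda>i. {a i<..<b i}) J"
        by (rule disjoint_family_on_mono[OF _ disj]) (auto simp: J_def)
    qed
    have "(\<Sum>k<card J. (b \<circ> \<sigma>) k - (a \<circ> \<sigma>) k) < d"
      using len sum_J[of "\<lambda>i. b i - a i"] sum.reindex_bij_betw[OF bij, of "\<lambda>i. b i - a i"] by simp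
    then have "(\<Sum>k<card J. \<bar>f ((b \<circ> \<sigma>) k) - f ((a \<circ> \<sigma>) k)\<bar>) < e"
      by (rule small[OF ordered])
    then show ?thesis
      using sum_J[of "\<lambda>i. \<bar>f (b i) - f (a i)\<bar>"] sum.reindex_bij_betw[OF bij, of "\<lambda>i. \<bar>f (b i) - f (a i)\<bar>"]
      by simp
  qed
  with \<open>d > 0\<close> show ?thesis
    using that by blast
qed

lemma measure_continuous_image_interval:
  fixes f :: "real \<Rightarrow> real"
  assumes "continuous_on {c..d} f" "c \<le> d"
  obtains a b where "c \<le> a" "a \<le> b" "b \<le> d" "f ` {c..d} \<in> lmeasurable"
    "measure lebesgue (f ` {c..d}) \<le> \<bar>f b - f a\<bar>"
proof -
  have K: "compact {c..d}" "{c..d} \<noteq> {}"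
    using assms(2) by auto
  obtain m where m: "m \<in> {c..d}" "\<And>y. y \<in> {c..d} \<Longrightarrow> f m \<le> f y"
    using continuous_attains_inf[OF K assms(1)] by blast
  obtain M where M: "M \<in> {c..d}" "\<And>y. y \<in> {c..d} \<Longrightarrow> f y \<le> f M"
    using continuous_attains_sup[OF K assms(1)] by blast
  have "f ` {c..d} \<in> lmeasurable"
    by (intro lmeasurable_compact compact_continuous_image assms(1) K(1))
  moreover have "measure lebesgue (f ` {c..d}) \<le> measure lebesgue {f m..f M}"
    using calculation m M by (intro measure_mono_fmeasurable) auto
  moreover have "measure lebesgue {f m..f M} = \<bar>f (max m M) - f (min m M)\<bar>"
    using m M by (auto simp: max_def min_def)
  ultimately show ?thesis
    using that[of "min m M" "max m M"] m M by auto
qed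

lemma measure_continuous_image_intervals:
  fixes f :: "real \<Rightarrow> real"
  assumes f: "continuous_on {0..1} f" and ab: "\<forall>i\<in>I. 0 \<le> a i \<and> a i \<le> b i \<and> b i \<le> 1"
  obtains a' b' where "\<forall>i\<in>I. a i \<le> a' i \<and> a' i \<le> b' i \<and> b' i \<le> b i"
    "\<forall>i\<in>I. f ` {a i..b i} \<in> lmeasurable \<and> measure lebesgue (f ` {a i..b i}) \<le> \<bar>f (b' i) - f (a' i)\<bar>"
proof -
  have "\<forall>i\<in>I. \<exists>a' b'. a i \<le> a' \<and> a' \<le> b' \<and> b' \<le> b i \<and> f ` {a i..b i} \<in> lmeasurable \<and>
      measure lebesgue (f ` {a i..b i}) \<le> \<bar>f b' - f a'\<bar>"
  proof
    fix i
    assume "i \<in> I"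
    then have "continuous_on {a i..b i} f" "a i \<le> b i"
      using ab continuous_on_subset[OF f] by auto
    from measure_continuous_image_interval[OF this]
    show "\<exists>a' b'. a i \<le> a' \<and> a' \<le> b' \<and> b' \<le> b i \<and> f ` {a i..b i} \<in> lmeasurable \<and>
        measure lebesgue (f ` {a i..b i}) \<le> \<bar>f b' - f a'\<bar>"
      by blast
  qed
  then show ?thesis
    using that by metis
qed

lemma abs_cont_01_measure_image_disjoint_family:
  assumes f: "abs_cont_01 f" and "e > 0"
  obtains d where "d > 0" "\<And>(I :: 'i set) a b. finite I \<Longrightarrow>
      \<forall>i\<in>I. 0 \<le> a i \<and> a i \<le> b i \<and> b i \<le> 1 \<Longrightarrow> disjoint_family_on (\<lambda>i. {a i<..<b i}) I \<Longrightarrow>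
      (\<Sum>i\<in>I. b i - a i) < d \<Longrightarrow> measure lebesgue (\<Union>i\<in>I. f ` {a i..b i}) < e"
proof -
  obtain d where "d > 0" and small: "\<And>(I :: 'i set) a b. finite I \<Longrightarrow>
      \<forall>i\<in>I. 0 \<le> a i \<and> a i \<le> b i \<and> b i \<le> 1 \<Longrightarrow> disjoint_family_on (\<lambda>i. {a i<..<b i}) I \<Longrightarrow>
      (\<Sum>i\<in>I. b i - a i) < d \<Longrightarrow> (\<Sum>i\<in>I. \<bar>f (b i) - f (a i)\<bar>) < e"
    using abs_cont_01_disjoint_family[OF assms] by blast
  have "measure lebesgue (\<Union>i\<in>I. f ` {a i..b i}) < e"
    if "finite I" and ab: "\<forall>i\<in>I. 0 \<le> a i \<and> a i \<le> b i \<and> b i \<le> 1"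
      and disj: "disjoint_family_on (\<lambda>i. {a i<..<b i}) I" and len: "(\<Sum>i\<in>I. b i - a i) < d"
    for I :: "'i set" and a b
  proof -
    obtain a' b' where ab': "\<forall>i\<in>I. a i \<le> a' i \<and> a' i \<le> b' i \<and> b' i \<le> b i"
      and image: "\<forall>i\<in>I. f ` {a i..b i} \<in> lmeasurable \<and>
        measure lebesgue (f ` {a i..b i}) \<le> \<bar>f (b' i) - f (a' i)\<bar>"
      using measure_continuous_image_intervals[OF abs_cont_01_imp_continuous_on[OF f] ab] by blast
    have "measure lebesgue (\<Union>i\<in>I. f ` {a i..b i}) \<le> (\<Sum>i\<in>I. measure lebesgue (f ` {a i..b i}))"
      using image by (intro measure_UNION_le \<open>finite I\<close>) (auto simp: fmeasurable_def)
    also have "\<dots> \<le> (\<Sum>i\<in>I. \<bar>f (b' i) - f (a' i)\<bar>)"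
      using image by (intro sum_mono) blast
    also have "\<dots> < e"
    proof (rule small[OF \<open>finite I\<close>])
      show "\<forall>i\<in>I. 0 \<le> a' i \<and> a' i \<le> b' i \<and> b' i \<le> 1"
        using ab ab' by fastforce
      have "{a' i<..<b' i} \<subseteq> {a i<..<b i}" if "i \<in> I" for i
        using ab' that by fastforce
      then show "disjoint_family_on (\<lambda>i. {a' i<..<b' i}) I"
        by (intro disjoint_family_on_bisimulation[OF disj]) blast
      have "(\<Sum>i\<in>I. b' i - a' i) \<le> (\<Sum>i\<in>I. b i - a i)"
        using ab' by (intro sum_mono) force
      then show "(\<Sum>i\<in>I. b' i - a' i) < d"
        using len by linarith
    qed
    finally show ?thesis .
  qed
  with \<open>d > 0\<close> show ?thesis
    using that by blast
qed

lemma measure_disjoint_open_intervals: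
  fixes a b :: "'i \<Rightarrow> real"
  assumes "finite I" "disjoint_family_on (\<lambda>i. {a i<..<b i}) I" "\<forall>i\<in>I. a i \<le> b i"
  shows "measure lebesgue (\<Union>i\<in>I. {a i<..<b i}) = (\<Sum>i\<in>I. b i - a i)"
  using assms by (subst measure_finite_Union) auto

lemma nonoverlapping_intervals_endpoints:
  fixes \<D> :: "real set set"
  assumes \<D>: "\<And>K. K \<in> \<D> \<Longrightarrow> K \<subseteq> cbox 0 1 \<and> K \<noteq> {} \<and> (\<exists>c d. K = cbox c d)"
    and pw: "pairwise (\<lambda>A B. interior A \<inter> interior B = {}) \<D>"
  obtains lo hi where "\<And>K. K \<in> \<D> \<Longrightarrow> {lo K..hi K} = K"
    "\<forall>K\<in>\<D>. 0 \<le> lo K \<and> lo K \<le> hi K \<and> hi K \<le> 1" "disjoint_family_on (\<lambda>K. {lo K<..<hi K}) \<D>"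
proof -
  have "\<forall>K\<in>\<D>. \<exists>c d. K = {c..d} \<and> 0 \<le> c \<and> c \<le> d \<and> d \<le> 1"
  proof
    fix K
    assume "K \<in> \<D>"
    then have "K \<subseteq> {0..1}" "K \<noteq> {}" "\<exists>c d. K = {c..d}"
      using \<D> by (simp_all add: cbox_interval)
    then obtain c d where "K = {c..d}" "K \<subseteq> {0..1}" "K \<noteq> {}"
      by blast
    then show "\<exists>c d. K = {c..d} \<and> 0 \<le> c \<and> c \<le> d \<and> d \<le> 1"
      by auto
  qed
  then obtain lo hi where K_eq: "\<And>K. K \<in> \<D> \<Longrightarrow> {lo K..hi K} = K"
    and K: "\<forall>K\<in>\<D>. 0 \<le> lo K \<and> lo K \<le> hi K \<and> hi K \<le> 1"
    by metis
  have interior_K: "interior K = {lo K<..<hi K}" if "K \<in> \<D>" for K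
    using interior_atLeastAtMost_real[of "lo K" "hi K"] unfolding K_eq[OF that] .
  have "disjoint_family_on (\<lambda>K. {lo K<..<hi K}) \<D>"
    unfolding disjoint_family_on_def
  proof (intro ballI impI)
    fix K K'
    assume "K \<in> \<D>" "K' \<in> \<D>" "K \<noteq> K'"
    then have "interior K \<inter> interior K' = {}"
      using pw by (auto simp: pairwise_def)
    with \<open>K \<in> \<D>\<close> \<open>K' \<in> \<D>\<close> show "{lo K<..<hi K} \<inter> {lo K'<..<hi K'} = {}"
      by (simp add: interior_K)
  qed
  with K_eq K show ?thesis
    using that by blast
qed

lemma negligible_outer_intervals_01:
  fixes N :: "real set" and d :: real
  assumes N: "N \<subseteq> {0..1}" "negligible N" and "d > 0"
  obtains \<D> :: "real set set" and lo hi where "countable \<D>" "N \<subseteq> (\<Union>K\<in>\<D>. {lo K..hi K})"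
    "\<forall>K\<in>\<D>. 0 \<le> lo K \<and> lo K \<le> hi K \<and> hi K \<le> 1" "disjoint_family_on (\<lambda>K. {lo K<..<hi K}) \<D>"
    "\<And>\<K>. \<K> \<subseteq> \<D> \<Longrightarrow> finite \<K> \<Longrightarrow> (\<Sum>K\<in>\<K>. hi K - lo K) < d"
proof -
  have "N \<in> lmeasurable" "N \<subseteq> cbox 0 1" "d / 2 > 0"
    using N \<open>d > 0\<close> by (auto intro: negligible_imp_measurable)
  then obtain \<D> where "countable \<D>"
    and \<D>: "\<And>K. K \<in> \<D> \<Longrightarrow> K \<subseteq> cbox 0 1 \<and> K \<noteq> {} \<and> (\<exists>c d. K = cbox c d)"
    and pw: "pairwise (\<lambda>A B. interior A \<inter> interior B = {}) \<D>"
    and cov: "N \<subseteq> \<Union>\<D>" and "\<Union>\<D> \<in> lmeasurable"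
    and meas_\<D>: "measure lebesgue (\<Union>\<D>) \<le> measure lebesgue N + d / 2"
    by (rule measurable_outer_intervals_bounded) blast
  obtain lo hi where K_eq: "\<And>K. K \<in> \<D> \<Longrightarrow> {lo K..hi K} = K"
    and K: "\<forall>K\<in>\<D>. 0 \<le> lo K \<and> lo K \<le> hi K \<and> hi K \<le> 1"
    and disj: "disjoint_family_on (\<lambda>K. {lo K<..<hi K}) \<D>"
    using nonoverlapping_intervals_endpoints[OF \<D> pw] by blast
  have "(\<Sum>K\<in>\<K>. hi K - lo K) < d" if "\<K> \<subseteq> \<D>" "finite \<K>" for \<K>
  proof -
    have "(\<Sum>K\<in>\<K>. hi K - lo K) = measure lebesgue (\<Union>K\<in>\<K>. {lo K<..<hi K})"
      using K that disjoint_family_on_mono[OF that(1) disj]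
      by (intro measure_disjoint_open_intervals[symmetric]) auto
    also have "\<dots> \<le> measure lebesgue (\<Union>\<D>)"
    proof (rule measure_mono_fmeasurable)
      have "{lo K<..<hi K} \<subseteq> K" if "K \<in> \<D>" for K
        using K_eq[OF that] greaterThanLessThan_subseteq_atLeastAtMost_iff[of "lo K" "hi K" "lo K" "hi K"]
        by simp
      then show "(\<Union>K\<in>\<K>. {lo K<..<hi K}) \<subseteq> \<Union>\<D>"
        using that by blast
      show "(\<Union>K\<in>\<K>. {lo K<..<hi K}) \<in> sets lebesgue"
        using \<open>finite \<K>\<close> by (intro sets.finite_UN) auto
    qed (rule \<open>\<Union>\<D> \<in> lmeasurable\<close>)
    also have "\<dots> < d"
      using meas_\<D> \<open>d > 0\<close> N(2) by (simp add: negligible_imp_measure0)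
    finally show ?thesis .
  qed
  moreover have "N \<subseteq> (\<Union>K\<in>\<D>. {lo K..hi K})"
    using cov by (auto simp: K_eq)
  ultimately show ?thesis
    using that \<open>countable \<D>\<close> K disj by blast
qed

lemma abs_cont_01_negligible_image:
  assumes f: "abs_cont_01 f" and N: "N \<subseteq> {0..1}" "negligible N"
  shows "negligible (f ` N)"
  unfolding negligible_outer_le
proof (intro allI impI)
  fix e :: real
  assume "e > 0"
  obtain d where "d > 0" and small: "\<And>(I :: real set set) a b. finite I \<Longrightarrow>
      \<forall>i\<in>I. 0 \<le> a i \<and> a i \<le> b i \<and> b i \<le> 1 \<Longrightarrow> disjoint_family_on (\<lambda>i. {a i<..<b i}) I \<Longrightarrow>
      (\<Sum>i\<in>I. b i - a i) < d \<Longrightarrow> measure lebesgue (\<Union>i\<in>I. f ` {a i..b i}) < e"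
    using abs_cont_01_measure_image_disjoint_family[OF f \<open>e > 0\<close>] by blast
  obtain \<D> :: "real set set" and lo hi where "countable \<D>" and cov: "N \<subseteq> (\<Union>K\<in>\<D>. {lo K..hi K})"
    and K: "\<forall>K\<in>\<D>. 0 \<le> lo K \<and> lo K \<le> hi K \<and> hi K \<le> 1"
    and disj: "disjoint_family_on (\<lambda>K. {lo K<..<hi K}) \<D>"
    and len: "\<And>\<K>. \<K> \<subseteq> \<D> \<Longrightarrow> finite \<K> \<Longrightarrow> (\<Sum>K\<in>\<K>. hi K - lo K) < d"
    using negligible_outer_intervals_01[OF N \<open>d > 0\<close>] by blast
  have meas: "f ` {lo K..hi K} \<in> lmeasurable" if "K \<in> \<D>" for K
    using K that
    by (intro lmeasurable_compact compact_continuous_image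
        continuous_on_subset[OF abs_cont_01_imp_continuous_on[OF f]]) auto
  have bound: "measure lebesgue (\<Union>K\<in>\<K>. f ` {lo K..hi K}) \<le> e" if "\<K> \<subseteq> \<D>" "finite \<K>" for \<K>
    using K that len[OF that] disjoint_family_on_mono[OF that(1) disj]
    by (intro less_imp_le small) auto
  have "(\<Union>K\<in>\<D>. f ` {lo K..hi K}) \<in> lmeasurable"
    by (rule fmeasurable_UN_bound[OF \<open>countable \<D>\<close> meas bound])
  moreover have "measure lebesgue (\<Union>K\<in>\<D>. f ` {lo K..hi K}) \<le> e"
    by (rule measure_UN_bound[OF \<open>countable \<D>\<close> meas bound])
  moreover have "f ` N \<subseteq> (\<Union>K\<in>\<D>. f ` {lo K..hi K})"
    using cov by blast
  ultimately show "\<exists>T. f ` N \<subseteq> T \<and> T \<in> lmeasurable \<and> measure lebesgue T \<le> e"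
    by blast
qed

section \<open>Approximation in L1 by continuous functions\<close>

definition clip :: "real \<Rightarrow> real \<Rightarrow> real" where
  "clip c y = max (- c) (min c y)"

lemma abs_clip_le: "\<bar>clip c y\<bar> \<le> \<bar>c\<bar>"
  by (auto simp: clip_def)

lemma abs_diff_clip_le: "c \<ge> 0 \<Longrightarrow> \<bar>y - clip c y\<bar> \<le> \<bar>y\<bar>"
  by (auto simp: clip_def)

lemma clip_eq_self: "\<bar>y\<bar> \<le> c \<Longrightarrow> clip c y = y"
  by (auto simp: clip_def)

lemma integral_abs_diff_clip_tendsto:
  fixes g :: "'a \<Rightarrow> real"
  assumes g: "integrable M g"
  shows "(\<lambda>m. \<integral>x. \<bar>g x - clip (real m) (g x)\<bar> \<partial>M) \<longlonglongrightarrow> 0"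
proof -
  have "(\<lambda>m. \<integral>x. \<bar>g x - clip (real m) (g x)\<bar> \<partial>M) \<longlonglongrightarrow> (\<integral>x. 0 \<partial>M)"
  proof (rule integral_dominated_convergence[where w = "\<lambda>x. \<bar>g x\<bar>"])
    show "(\<lambda>x. \<bar>g x - clip (real m) (g x)\<bar>) \<in> borel_measurable M" for m
      using borel_measurable_integrable[OF g] unfolding clip_def by measurable
    show "AE x in M. (\<lambda>m. \<bar>g x - clip (real m) (g x)\<bar>) \<longlonglongrightarrow> 0"
    proof (rule AE_I2)
      fix x
      obtain m0 :: nat where "\<bar>g x\<bar> \<le> real m0"
        using real_arch_simple by blast
      then have "\<forall>m\<ge>m0. \<bar>g x - clip (real m) (g x)\<bar> = 0"
        by (auto simp: clip_eq_self)
      then show "(\<lambda>m. \<bar>g x - clip (real m) (g x)\<bar>) \<longlonglongrightarrow> 0"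
        by (intro tendsto_eventually) (auto simp: eventually_sequentially)
    qed
    show "AE x in M. norm \<bar>g x - clip (real m) (g x)\<bar> \<le> \<bar>g x\<bar>" for m
      by (intro AE_I2) (simp add: abs_diff_clip_le)
  qed (use g in auto)
  then show ?thesis
    by simp
qed

lemma integral_abs_diff_clip_AE_limit:
  fixes g :: "'a \<Rightarrow> real"
  assumes M: "finite_measure M" and g: "g \<in> borel_measurable M"
    and q: "\<And>n. q n \<in> borel_measurable M" and lim: "AE x in M. (\<lambda>n. q n x) \<longlonglongrightarrow> g x"
  shows "(\<lambda>n. \<integral>x. \<bar>clip c (g x) - clip c (q n x)\<bar> \<partial>M) \<longlonglongrightarrow> 0"
proof -
  have "(\<lambda>n. \<integral>x. \<bar>clip c (g x) - clip c (q n x)\<bar> \<partial>M) \<longlonglongrightarrow> (\<integral>x. 0 \<partial>M)"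
  proof (rule integral_dominated_convergence[where w = "\<lambda>x. 2 * \<bar>c\<bar>"])
    show "(\<lambda>x. \<bar>clip c (g x) - clip c (q n x)\<bar>) \<in> borel_measurable M" for n
      using g q[of n] unfolding clip_def by measurable
    show "integrable M (\<lambda>x. 2 * \<bar>c\<bar>)"
      using M by (rule finite_measure.integrable_const)
    show "AE x in M. (\<lambda>n. \<bar>clip c (g x) - clip c (q n x)\<bar>) \<longlonglongrightarrow> 0"
      using lim
    proof (rule AE_mp, intro AE_I2 impI)
      fix x
      assume "(\<lambda>n. q n x) \<longlonglongrightarrow> g x"
      then have "(\<lambda>n. clip c (q n x)) \<longlonglongrightarrow> clip c (g x)"
        unfolding clip_def by (intro tendsto_intros)
      then have "(\<lambda>n. clip c (g x) - clip c (q n x)) \<longlonglongrightarrow> 0"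
        using tendsto_diff[OF tendsto_const[of "clip c (g x)"]] by fastforce
      then show "(\<lambda>n. \<bar>clip c (g x) - clip c (q n x)\<bar>) \<longlonglongrightarrow> 0"
        by (rule tendsto_rabs_zero)
    qed
    show "AE x in M. norm \<bar>clip c (g x) - clip c (q n x)\<bar> \<le> 2 * \<bar>c\<bar>" for n
    proof (rule AE_I2)
      fix x
      show "norm \<bar>clip c (g x) - clip c (q n x)\<bar> \<le> 2 * \<bar>c\<bar>"
        using abs_clip_le[of c "g x"] abs_clip_le[of c "q n x"] by simp
    qed
  qed simp
  then show ?thesis
    by simp
qed

lemma borel_measurable_lebesgue_on_AE_limit_continuous:
  fixes g :: "'a::euclidean_space \<Rightarrow> real"
  assumes g: "g \<in> borel_measurable (lebesgue_on S)" and S: "S \<in> sets lebesgue"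
  obtains q where "\<And>n. continuous_on UNIV (q n)" "AE x in lebesgue_on S. (\<lambda>n. q n x) \<longlonglongrightarrow> g x"
proof -
  obtain N q where N: "negligible N" and q: "\<And>n. continuous_on UNIV (q n)"
    and lim: "\<And>x. x \<notin> N \<Longrightarrow> (\<lambda>n. q n x) \<longlonglongrightarrow> (if x \<in> S then g x else 0)"
    using g measurable_on_iff_borel_measurable[OF S] unfolding measurable_on_def by blast
  have "AE x in lebesgue. x \<notin> N"
    using N by (intro AE_not_in) (simp add: negligible_iff_null_sets)
  then have "AE x in lebesgue. x \<in> S \<longrightarrow> (\<lambda>n. q n x) \<longlonglongrightarrow> g x"
    by (rule AE_mp) (auto intro!: AE_I2 dest: lim)
  then have "AE x in lebesgue_on S. (\<lambda>n. q n x) \<longlonglongrightarrow> g x"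
    using S by (simp add: AE_restrict_space_iff)
  with q show ?thesis
    using that by blast
qed

lemma integral_abs_diff_triangle:
  fixes f g h :: "'a \<Rightarrow> real"
  assumes "integrable M f" "integrable M g" "integrable M h"
  shows "(\<integral>x. \<bar>f x - h x\<bar> \<partial>M) \<le> (\<integral>x. \<bar>f x - g x\<bar> \<partial>M) + (\<integral>x. \<bar>g x - h x\<bar> \<partial>M)"
proof -
  have "(\<integral>x. \<bar>f x - h x\<bar> \<partial>M) \<le> (\<integral>x. \<bar>f x - g x\<bar> + \<bar>g x - h x\<bar> \<partial>M)"
    using assms by (intro integral_mono) auto
  also have "\<dots> = (\<integral>x. \<bar>f x - g x\<bar> \<partial>M) + (\<integral>x. \<bar>g x - h x\<bar> \<partial>M)"
    using assms by (intro Bochner_Integration.integral_add) auto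
  finally show ?thesis .
qed

lemma continuous_approximation_L1:
  fixes g :: "'a::euclidean_space \<Rightarrow> real"
  assumes S: "S \<in> lmeasurable" and g: "integrable (lebesgue_on S) g" and "e > 0"
  obtains p where "continuous_on UNIV p" "(\<integral>x. \<bar>g x - p x\<bar> \<partial>lebesgue_on S) < e"
proof -
  let ?M = "lebesgue_on S"
  have fin: "finite_measure ?M"
    using S by (rule finite_measure_lebesgue_on)
  have clip_integrable: "integrable ?M (\<lambda>x. clip c (u x))" if "u \<in> borel_measurable ?M" for u c
    using that abs_clip_le[of c]
    by (intro finite_measure.integrable_const_bound[OF fin, where B = "\<bar>c\<bar>"] AE_I2)
      (auto simp: clip_def)
  have "eventually (\<lambda>m. (\<integral>x. \<bar>g x - clip (real m) (g x)\<bar> \<partial>?M) < e / 2) sequentially"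
    using \<open>e > 0\<close> by (intro order_tendstoD(2)[OF integral_abs_diff_clip_tendsto[OF g]]) auto
  then obtain m where m: "(\<integral>x. \<bar>g x - clip (real m) (g x)\<bar> \<partial>?M) < e / 2"
    by (auto simp: eventually_sequentially)
  obtain q where q: "\<And>n. continuous_on UNIV (q n)" and lim: "AE x in ?M. (\<lambda>n. q n x) \<longlonglongrightarrow> g x"
    using borel_measurable_lebesgue_on_AE_limit_continuous[OF borel_measurable_integrable[OF g]] S
    by (metis fmeasurableD)
  have q_meas: "q n \<in> borel_measurable ?M" for n
    using q[of n] S by (intro continuous_imp_measurable_on_sets_lebesgue) (auto intro: continuous_on_subset)
  have "eventually (\<lambda>n. (\<integral>x. \<bar>clip (real m) (g x) - clip (real m) (q n x)\<bar> \<partial>?M) < e / 2) sequentially"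
    using \<open>e > 0\<close> borel_measurable_integrable[OF g] q_meas
    by (intro order_tendstoD(2)[OF integral_abs_diff_clip_AE_limit[OF fin _ _ lim]]) auto
  then obtain n where n: "(\<integral>x. \<bar>clip (real m) (g x) - clip (real m) (q n x)\<bar> \<partial>?M) < e / 2"
    by (auto simp: eventually_sequentially)
  have cont: "continuous_on UNIV (\<lambda>x. clip (real m) (q n x))"
    unfolding clip_def by (intro continuous_intros q)
  have triangle: "(\<integral>x. \<bar>g x - clip (real m) (q n x)\<bar> \<partial>?M)
      \<le> (\<integral>x. \<bar>g x - clip (real m) (g x)\<bar> \<partial>?M)
        + (\<integral>x. \<bar>clip (real m) (g x) - clip (real m) (q n x)\<bar> \<partial>?M)"
    by (rule integral_abs_diff_triangle[OF g clip_integrable clip_integrable])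
      (use borel_measurable_integrable[OF g] q_meas in auto)
  show ?thesis
    using m n triangle by (intro that[OF cont]) linarith
qed

section \<open>Fundamental theorem of calculus for absolutely continuous functions\<close>

lemma lmeasurable_vec_image_real:
  fixes T :: "real set"
  assumes "(vec ` T :: (real^1) set) \<in> lmeasurable"
  shows "T \<in> lmeasurable" "measure lebesgue T = measure lebesgue (vec ` T :: (real^1) set)"
proof -
  have "((\<lambda>x::real^1. 1::real) has_integral measure lebesgue (vec ` T :: (real^1) set)) (vec ` T)"
    using assms by (simp add: lmeasure_integral lmeasurable_iff_integrable_on integrable_integral)
  then have "((\<lambda>x::real^1. 1::real) \<circ> vec has_integral measure lebesgue (vec ` T :: (real^1) set))
      ((\<lambda>x. x $ 1) ` (vec ` T :: (real^1) set))"
    by (rule has_integral_vec1_I)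
  then have T: "((\<lambda>x. 1::real) has_integral measure lebesgue (vec ` T :: (real^1) set)) T"
    by (simp add: o_def image_image)
  then show "T \<in> lmeasurable"
    by (auto simp: lmeasurable_iff_integrable_on has_integral_integrable)
  with T show "measure lebesgue T = measure lebesgue (vec ` T :: (real^1) set)"
    by (simp add: lmeasure_integral integral_unique)
qed

lemma measure_differentiable_image_real_le:
  fixes h h' :: "real \<Rightarrow> real"
  assumes S: "S \<in> sets lebesgue"
    and der: "\<And>x. x \<in> S \<Longrightarrow> (h has_real_derivative h' x) (at x within S)"
    and int: "(\<lambda>x. \<bar>h' x\<bar>) integrable_on S"
  shows "h ` S \<in> lmeasurable" "measure lebesgue (h ` S) \<le> integral S (\<lambda>x. \<bar>h' x\<bar>)"
proof -
  \<comment> \<open>The library's bound for the measure of a differentiable image is stated on \<open>real^'n\<close>.\<close>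
  define S' :: "(real^1) set" where "S' = vec ` S"
  define F :: "real^1 \<Rightarrow> real^1" where "F x = vec (h (x $ 1))" for x
  have S': "S' \<in> sets lebesgue"
    unfolding S'_def by (auto intro: differentiable_image_in_sets_lebesgue [OF S] differentiable_vec)
  have der': "(F has_derivative (*\<^sub>R) (h' (x $ 1))) (at x within S')" if x: "x \<in> S'" for x
  proof -
    obtain z where z: "z \<in> S" "x = vec z"
      using x unfolding S'_def by blast
    have "(h has_derivative (\<lambda>y. y * h' z)) (at z within S)"
      using der[OF z(1)] by (simp add: has_field_derivative_def mult_commute_abs)
    from has_derivative_vector_1[where g = h and g' = h' and a = z and S = S, OF this]
    show ?thesis
      using z unfolding F_def S'_def by simp
  qed
  have "((\<lambda>x::real^1. \<bar>h' (x $ 1)\<bar>) \<circ> vec has_integral integral S (\<lambda>x. \<bar>h' x\<bar>)) ((\<lambda>x. x $ 1) ` S')"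
    using int unfolding S'_def by (simp add: o_def image_image integrable_integral)
  then have int': "((\<lambda>x::real^1. \<bar>h' (x $ 1)\<bar>) has_integral integral S (\<lambda>x. \<bar>h' x\<bar>)) S'"
    by (rule has_integral_vec1_D)
  then have int_det: "(\<lambda>x. \<bar>det (matrix ((*\<^sub>R) (h' (x $ 1)) :: real^1 \<Rightarrow> real^1))\<bar>) integrable_on S'"
    by (auto simp: has_integral_integrable)
  have image: "F ` S' = vec ` h ` S"
    unfolding F_def S'_def by (auto simp: image_image)
  have vec_image: "(vec ` h ` S :: (real^1) set) \<in> lmeasurable"
    using measurable_differentiable_image[OF S' der' int_det] unfolding image .
  then show "h ` S \<in> lmeasurable"
    by (rule lmeasurable_vec_image_real(1))
  have "measure lebesgue (F ` S')
      \<le> integral S' (\<lambda>x. \<bar>det (matrix ((*\<^sub>R) (h' (x $ 1)) :: real^1 \<Rightarrow> real^1))\<bar>)"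
    by (rule measure_differentiable_image[OF S' der' int_det])
  also have "\<dots> = integral S (\<lambda>x. \<bar>h' x\<bar>)"
    using int' by (simp add: integral_unique)
  finally show "measure lebesgue (h ` S) \<le> integral S (\<lambda>x. \<bar>h' x\<bar>)"
    using lmeasurable_vec_image_real(2)[OF vec_image] unfolding image by simp
qed

lemma abs_diff_le_measure_continuous_image:
  fixes h :: "real \<Rightarrow> real"
  assumes "continuous_on {0..1} h"
  shows "\<bar>h 1 - h 0\<bar> \<le> measure lebesgue (h ` {0..1})"
proof -
  have "{min (h 0) (h 1)..max (h 0) (h 1)} \<subseteq> h ` {0..1}"
    by (rule connected_contains_Icc) (auto intro: connected_continuous_image[OF assms] simp: min_def max_def)
  then have "measure lebesgue {min (h 0) (h 1)..max (h 0) (h 1)} \<le> measure lebesgue (h ` {0..1})"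
    by (intro measure_mono_fmeasurable lmeasurable_compact compact_continuous_image assms) auto
  then show ?thesis
    by (simp add: min_def max_def split: if_splits)
qed

lemma negligible_diff_imp_sets_lebesgue:
  assumes "D \<subseteq> S" "S \<in> sets lebesgue" "negligible (S - D)"
  shows "D \<in> sets lebesgue"
proof -
  have "D = S - (S - D)"
    using assms(1) by auto
  also have "\<dots> \<in> sets lebesgue"
    using assms(2) negligible_imp_sets[OF assms(3)] by (rule sets.Diff)
  finally show ?thesis .
qed

lemma integrable_on_abs_subset:
  fixes k :: "'a::euclidean_space \<Rightarrow> real"
  assumes "integrable (lebesgue_on S) k" "S \<in> sets lebesgue" "D \<in> sets lebesgue" "D \<subseteq> S"
  shows "(\<lambda>t. \<bar>k t\<bar>) integrable_on D"
proof -
  have "(\<lambda>t. \<bar>k t\<bar>) integrable_on S"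
    using assms(1,2) by (intro integrable_on_lebesgue_on) auto
  then have "(\<lambda>t. \<bar>k t\<bar>) absolutely_integrable_on S"
    by (subst absolutely_integrable_on_iff_nonneg) auto
  then have "(\<lambda>t. \<bar>k t\<bar>) absolutely_integrable_on D"
    by (rule set_integrable_subset[OF _ assms(3,4)])
  then show ?thesis
    by (rule set_lebesgue_integral_eq_integral(1))
qed

lemma abs_cont_01_increment_le_integral:
  fixes h k :: "real \<Rightarrow> real"
  assumes h: "abs_cont_01 h"
    and D: "D \<subseteq> {0..1}" "negligible ({0..1} - D)"
    and der: "\<And>t. t \<in> D \<Longrightarrow> (h has_real_derivative k t) (at t within D)"
    and k: "integrable (lebesgue_on {0..1}) k"
  shows "\<bar>h 1 - h 0\<bar> \<le> integral\<^sup>L (lebesgue_on {0..1}) (\<lambda>t. \<bar>k t\<bar>)"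
proof -
  have D_meas: "D \<in> sets lebesgue"
    by (rule negligible_diff_imp_sets_lebesgue[OF D(1) _ D(2)]) simp
  have k01: "(\<lambda>t. \<bar>k t\<bar>) integrable_on {0..1}"
    by (rule integrable_on_abs_subset[OF k]) auto
  have kD: "(\<lambda>t. \<bar>k t\<bar>) integrable_on D"
    by (rule integrable_on_abs_subset[OF k _ D_meas D(1)]) simp
  note h_D = measure_differentiable_image_real_le[OF D_meas der kD]
  have h_rest: "negligible (h ` ({0..1} - D))"
    by (rule abs_cont_01_negligible_image[OF h _ D(2)]) auto
  have "\<bar>h 1 - h 0\<bar> \<le> measure lebesgue (h ` {0..1})"
    by (rule abs_diff_le_measure_continuous_image[OF abs_cont_01_imp_continuous_on[OF h]])
  also have "\<dots> \<le> measure lebesgue (h ` D \<union> h ` ({0..1} - D))"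
  proof (rule measure_mono_fmeasurable)
    show "h ` {0..1} \<in> sets lebesgue"
      by (intro fmeasurableD lmeasurable_compact compact_continuous_image
          abs_cont_01_imp_continuous_on h) auto
    show "h ` D \<union> h ` ({0..1} - D) \<in> lmeasurable"
      using h_D(1) negligible_imp_measurable[OF h_rest] by (rule fmeasurable.Un)
  qed auto
  also have "\<dots> = measure lebesgue (h ` D)"
    using h_D(1) h_rest by (intro measure_Un_null_set) (auto simp: negligible_iff_null_sets)
  also have "\<dots> \<le> integral D (\<lambda>t. \<bar>k t\<bar>)"
    by (rule h_D(2))
  also have "\<dots> \<le> integral {0..1} (\<lambda>t. \<bar>k t\<bar>)"
    by (rule integral_subset_le[OF D(1) kD k01]) auto
  also have "\<dots> = integral\<^sup>L (lebesgue_on {0..1}) (\<lambda>t. \<bar>k t\<bar>)"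
    using k by (intro lebesgue_integral_eq_integral[symmetric]) auto
  finally show ?thesis .
qed

lemma AE_lebesgue_on_imp_negligible:
  assumes "AE x in lebesgue_on S. P x" "S \<in> sets lebesgue"
  shows "negligible {x \<in> S. \<not> P x}"
proof -
  have "AE x in lebesgue. x \<in> S \<longrightarrow> P x"
    using assms by (subst (asm) AE_restrict_space_iff) auto
  then obtain N where N: "{x \<in> space lebesgue. \<not> (x \<in> S \<longrightarrow> P x)} \<subseteq> N"
    "emeasure lebesgue N = 0" "N \<in> sets lebesgue"
    by (rule AE_E)
  then have "negligible N"
    by (simp add: negligible_iff_null_sets null_sets_def)
  moreover have "{x \<in> S. \<not> P x} \<subseteq> N"
    using N(1) by auto
  ultimately show ?thesis
    by (rule negligible_subset)
qed

lemma abs_cont_01_increment_approx: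
  fixes f g p :: "real \<Rightarrow> real"
  assumes f: "abs_cont_01 f" and D: "D \<subseteq> {0..1}" "negligible ({0..1} - D)"
    and der: "\<And>t. t \<in> D \<Longrightarrow> (f has_real_derivative g t) (at t)"
    and g: "integrable (lebesgue_on {0..1}) g" and p: "continuous_on {0..1} p"
  shows "\<bar>f 1 - f 0 - integral\<^sup>L (lebesgue_on {0..1}) g\<bar>
    \<le> 2 * integral\<^sup>L (lebesgue_on {0..1}) (\<lambda>t. \<bar>g t - p t\<bar>)"
proof -
  let ?M = "lebesgue_on {0..1::real}"
  let ?P = "\<lambda>t. integral {0..t} p"
  have int_p: "integrable ?M p"
    using p by (rule continuous_imp_integrable_real)
  have "\<bar>(f 1 - ?P 1) - (f 0 - ?P 0)\<bar> \<le> integral\<^sup>L ?M (\<lambda>t. \<bar>g t - p t\<bar>)"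
  proof (rule abs_cont_01_increment_le_integral[OF _ D])
    show "abs_cont_01 (\<lambda>t. f t - ?P t)"
      by (intro abs_cont_01_diff f abs_cont_01_integral_continuous p)
    show "((\<lambda>t. f t - ?P t) has_real_derivative g t - p t) (at t within D)" if "t \<in> D" for t
    proof (rule DERIV_diff)
      show "(f has_real_derivative g t) (at t within D)"
        using der[OF that] by (rule has_field_derivative_at_within)
      have "t \<in> {0..1}"
        using that D(1) by blast
      from has_field_derivative_subset[OF integral_has_real_derivative[OF p this] D(1)]
      show "(?P has_real_derivative p t) (at t within D)" .
    qed
  qed (use g int_p in simp)
  moreover have "?P 1 = integral\<^sup>L ?M p"
    using int_p by (simp add: lebesgue_integral_eq_integral)
  moreover have "\<bar>integral\<^sup>L ?M p - integral\<^sup>L ?M g\<bar> \<le> integral\<^sup>L ?M (\<lambda>t. \<bar>g t - p t\<bar>)"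
    using integral_abs_bound[of ?M "\<lambda>t. g t - p t"] g int_p by simp
  ultimately show ?thesis
    by simp
qed

lemma abs_cont_01_integral_derivative:
  fixes f g :: "real \<Rightarrow> real"
  assumes f: "abs_cont_01 f"
    and der: "AE t in lebesgue_on {0..1}. (f has_real_derivative g t) (at t)"
    and g: "integrable (lebesgue_on {0..1}) g"
  shows "integral\<^sup>L (lebesgue_on {0..1}) g = f 1 - f 0"
proof -
  define D where "D = {t \<in> {0..1}. (f has_real_derivative g t) (at t)}"
  have D_sub: "D \<subseteq> {0..1}"
    unfolding D_def by blast
  have "negligible {t \<in> {0..1}. \<not> (f has_real_derivative g t) (at t)}"
    by (rule AE_lebesgue_on_imp_negligible[OF der]) simp
  also have "{t \<in> {0..1}. \<not> (f has_real_derivative g t) (at t)} = {0..1} - D"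
    by (auto simp: D_def)
  finally have D_neg: "negligible ({0..1} - D)" .
  have "\<bar>f 1 - f 0 - integral\<^sup>L (lebesgue_on {0..1}) g\<bar> \<le> 0"
  proof (rule field_le_epsilon)
    fix e :: real
    assume "e > 0"
    then obtain p where p: "continuous_on UNIV p"
      and "integral\<^sup>L (lebesgue_on {0..1}) (\<lambda>t. \<bar>g t - p t\<bar>) < e / 2"
      using continuous_approximation_L1[OF _ g, of "e / 2"] by auto
    moreover have "\<bar>f 1 - f 0 - integral\<^sup>L (lebesgue_on {0..1}) g\<bar>
        \<le> 2 * integral\<^sup>L (lebesgue_on {0..1}) (\<lambda>t. \<bar>g t - p t\<bar>)"
      using continuous_on_subset[OF p]
      by (intro abs_cont_01_increment_approx[OF f D_sub D_neg _ g]) (auto simp: D_def)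
    ultimately show "\<bar>f 1 - f 0 - integral\<^sup>L (lebesgue_on {0..1}) g\<bar> \<le> 0 + e"
      by linarith
  qed
  then show ?thesis
    by simp
qed

section \<open>Square integrable functions\<close>

lemma L2_01_imp_integrable:
  assumes "L2_01 u"
  shows "integrable (lebesgue_on {0..1}) u"
proof (rule Bochner_Integration.integrable_bound[where f = "\<lambda>t. 1 + (u t)\<^sup>2"])
  show "integrable (lebesgue_on {0..1}) (\<lambda>t. 1 + (u t)\<^sup>2)"
    using assms unfolding L2_01_def by simp
  show "u \<in> borel_measurable (lebesgue_on {0..1})"
    using assms unfolding L2_01_def by simp
  have "\<bar>y\<bar> \<le> 1 + y\<^sup>2" for y :: real
  proof (cases "\<bar>y\<bar> \<le> 1")
    case False
    then have "\<bar>y\<bar> * 1 \<le> \<bar>y\<bar> * \<bar>y\<bar>"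
      by (intro mult_left_mono) auto
    then show ?thesis
      by (simp add: power2_eq_square abs_mult_self_eq)
  qed (simp add: add_increasing2)
  then show "AE t in lebesgue_on {0..1}. norm (u t) \<le> norm (1 + (u t)\<^sup>2)"
    by (intro AE_I2) simp
qed

lemma L2_01_imp_integrable_mult_ident:
  assumes "L2_01 u"
  shows "integrable (lebesgue_on {0..1}) (\<lambda>t. t * u t)"
proof (rule Bochner_Integration.integrable_bound[where f = u])
  show "integrable (lebesgue_on {0..1}) u"
    using assms by (rule L2_01_imp_integrable)
  have "(\<lambda>t. t) \<in> borel_measurable (lebesgue_on {0..1::real})"
    by (intro continuous_imp_measurable_on_sets_lebesgue continuous_on_id) auto
  then show "(\<lambda>t. t * u t) \<in> borel_measurable (lebesgue_on {0..1})"
    using assms unfolding L2_01_def by (intro borel_measurable_times) auto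
  show "AE t in lebesgue_on {0..1}. norm (t * u t) \<le> norm (u t)"
    by (intro AE_I2) (auto simp: abs_mult intro: mult_left_le_one_le)
qed

lemma L2_01_add:
  assumes f: "L2_01 f" and g: "L2_01 g"
  shows "L2_01 (\<lambda>t. f t + g t)"
  unfolding L2_01_def
proof
  show meas: "(\<lambda>t. f t + g t) \<in> borel_measurable (lebesgue_on {0..1})"
    using f g unfolding L2_01_def by (intro borel_measurable_add) auto
  show "integrable (lebesgue_on {0..1}) (\<lambda>t. (f t + g t)\<^sup>2)"
  proof (rule Bochner_Integration.integrable_bound[where f = "\<lambda>t. 2 * (f t)\<^sup>2 + 2 * (g t)\<^sup>2"])
    show "integrable (lebesgue_on {0..1}) (\<lambda>t. 2 * (f t)\<^sup>2 + 2 * (g t)\<^sup>2)"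
      using f g unfolding L2_01_def by simp
    show "(\<lambda>t. (f t + g t)\<^sup>2) \<in> borel_measurable (lebesgue_on {0..1})"
      using meas by (rule borel_measurable_power)
    have "(y + z)\<^sup>2 \<le> 2 * y\<^sup>2 + 2 * z\<^sup>2" for y z :: real
      using zero_le_power2[of "y - z"] by (simp add: power2_eq_square algebra_simps)
    then show "AE t in lebesgue_on {0..1}. norm ((f t + g t)\<^sup>2) \<le> norm (2 * (f t)\<^sup>2 + 2 * (g t)\<^sup>2)"
      by (intro AE_I2) simp
  qed
qed

lemma L2_01_cmult:
  assumes "L2_01 f"
  shows "L2_01 (\<lambda>t. c * f t)"
  using assms unfolding L2_01_def by (auto simp: power_mult_distrib)

lemma L2_01_diff:
  assumes "L2_01 f" "L2_01 g"
  shows "L2_01 (\<lambda>t. f t - g t)"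
  using L2_01_add[OF assms(1) L2_01_cmult[OF assms(2), of "-1"]] by simp

lemma continuous_imp_L2_01:
  assumes "continuous_on {0..1} q"
  shows "L2_01 q"
  unfolding L2_01_def
proof
  show "q \<in> borel_measurable (lebesgue_on {0..1})"
    using assms by (intro continuous_imp_measurable_on_sets_lebesgue) auto
  show "integrable (lebesgue_on {0..1}) (\<lambda>t. (q t)\<^sup>2)"
    using assms by (intro continuous_imp_integrable_real continuous_intros)
qed

section \<open>The projection onto the admissible controls\<close>

lemma admissible_moments:
  assumes "u \<in> admissible s0 sf v0 vf"
  shows "integral\<^sup>L (lebesgue_on {0..1}) u = vf - v0"
    and "integral\<^sup>L (lebesgue_on {0..1}) (\<lambda>t. t * u t) = s0 + vf - sf"
proof -
  obtain x1 x2 where u: "L2_01 u" and x: "W12_01 x1" "W12_01 x2"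
    and der: "AE t in lebesgue_on {0..1}. (x1 has_real_derivative x2 t) (at t)
                                          \<and> (x2 has_real_derivative u t) (at t)"
    and bc: "x1 0 = s0" "x1 1 = sf" "x2 0 = v0" "x2 1 = vf"
    using assms unfolding admissible_def by blast
  have ac: "abs_cont_01 x1" "abs_cont_01 x2"
    using x unfolding W12_01_def by auto
  have "integral\<^sup>L (lebesgue_on {0..1}) u = x2 1 - x2 0"
    using der by (intro abs_cont_01_integral_derivative ac L2_01_imp_integrable u) (auto elim: AE_mp)
  then show "integral\<^sup>L (lebesgue_on {0..1}) u = vf - v0"
    using bc by simp
  have "AE t in lebesgue_on {0..1}. ((\<lambda>t. x1 t - t * x2 t) has_real_derivative - (t * u t)) (at t)"
    using der
  proof (rule AE_mp, intro AE_I2 impI)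
    fix t
    assume "(x1 has_real_derivative x2 t) (at t) \<and> (x2 has_real_derivative u t) (at t)"
    then have "((\<lambda>t. x1 t - t * x2 t) has_real_derivative x2 t - (1 * x2 t + u t * t)) (at t)"
      by (intro DERIV_diff DERIV_mult DERIV_ident) auto
    then show "((\<lambda>t. x1 t - t * x2 t) has_real_derivative - (t * u t)) (at t)"
      by (rule DERIV_cong) (simp add: algebra_simps)
  qed
  then have "integral\<^sup>L (lebesgue_on {0..1}) (\<lambda>t. - (t * u t)) = (x1 1 - 1 * x2 1) - (x1 0 - 0 * x2 0)"
    using L2_01_imp_integrable_mult_ident[OF u]
    by (intro abs_cont_01_integral_derivative abs_cont_01_diff abs_cont_01_mult ac abs_cont_01_ident) auto
  then show "integral\<^sup>L (lebesgue_on {0..1}) (\<lambda>t. t * u t) = s0 + vf - sf"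
    using bc by simp
qed

lemma admissible_add_affine:
  assumes u: "L2_01 u" and x: "W12_01 x1" "W12_01 x2"
    and der: "AE t in lebesgue_on {0..1}. (x1 has_real_derivative x2 t) (at t)
                                          \<and> (x2 has_real_derivative u t) (at t)"
  shows "(\<lambda>t. u t + a * t + b) \<in> admissible (x1 0) (x1 1 + a / 6 + b / 2) (x2 0) (x2 1 + a / 2 + b)"
proof -
  define y1 where "y1 t = x1 t + (a / 6 * (t * t * t) + b / 2 * (t * t))" for t
  define y2 where "y2 t = x2 t + (a / 2 * (t * t) + b * t)" for t
  define p where "p t = u t + a * t + b" for t
  have L2: "L2_01 x1" "L2_01 x2"
    using x unfolding W12_01_def by auto
  have "L2_01 (\<lambda>t. u t + (a * t + b))" "L2_01 y1" "L2_01 y2"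
    unfolding y1_def y2_def
    by (intro L2_01_add u L2 continuous_imp_L2_01 continuous_intros)+
  then have L2_y: "L2_01 p" "L2_01 y1" "L2_01 y2"
    unfolding p_def by (simp_all add: add.assoc)
  have ac_y: "abs_cont_01 y1" "abs_cont_01 y2"
    using x unfolding y1_def y2_def W12_01_def
    by (intro abs_cont_01_add abs_cont_01_mult abs_cont_01_const abs_cont_01_ident; simp)+
  have der_y: "AE t in lebesgue_on {0..1}. (y1 has_real_derivative y2 t) (at t)
                                          \<and> (y2 has_real_derivative p t) (at t)"
    using der
  proof (rule AE_mp, intro AE_I2 impI conjI)
    fix t
    assume d: "(x1 has_real_derivative x2 t) (at t) \<and> (x2 has_real_derivative u t) (at t)"
    have "(y1 has_real_derivative
        x2 t + (a / 6 * ((1 * t + 1 * t) * t + 1 * (t * t)) + b / 2 * (1 * t + 1 * t))) (at t)"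
      unfolding y1_def using d by (intro DERIV_add DERIV_cmult DERIV_mult DERIV_ident) auto
    then show "(y1 has_real_derivative y2 t) (at t)"
      by (rule DERIV_cong) (simp add: y2_def algebra_simps)
    have "(y2 has_real_derivative u t + (a / 2 * (1 * t + 1 * t) + b * 1)) (at t)"
      unfolding y2_def using d by (intro DERIV_add DERIV_cmult DERIV_mult DERIV_ident) auto
    then show "(y2 has_real_derivative p t) (at t)"
      by (rule DERIV_cong) (simp add: p_def algebra_simps)
  qed
  have "W12_01 y1" "W12_01 y2"
    unfolding W12_01_def using L2_y ac_y der_y by (auto elim: AE_mp)
  moreover have "y1 0 = x1 0" "y1 1 = x1 1 + a / 6 + b / 2" "y2 0 = x2 0" "y2 1 = x2 1 + a / 2 + b"
    by (simp_all add: y1_def y2_def)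
  ultimately show ?thesis
    unfolding admissible_def p_def[symmetric] using L2_y(1) der_y by blast
qed

lemma integral_square_add_affine_orthogonal:
  assumes w: "L2_01 w"
    and w_orth: "integral\<^sup>L (lebesgue_on {0..1}) w = 0" "integral\<^sup>L (lebesgue_on {0..1}) (\<lambda>t. t * w t) = 0"
  shows "integral\<^sup>L (lebesgue_on {0..1}) (\<lambda>t. (w t + (a * t + b))\<^sup>2)
    = integral\<^sup>L (lebesgue_on {0..1}) (\<lambda>t. (w t)\<^sup>2) + integral\<^sup>L (lebesgue_on {0..1}) (\<lambda>t. (a * t + b)\<^sup>2)"
proof -
  let ?M = "lebesgue_on {0..1::real}"
  have "continuous_on {0..1} (\<lambda>t. (a * t + b)\<^sup>2)"
    by (intro continuous_intros)
  then have int: "integrable ?M (\<lambda>t. (w t)\<^sup>2)" "integrable ?M (\<lambda>t. t * w t)" "integrable ?M w"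
    "integrable ?M (\<lambda>t. (a * t + b)\<^sup>2)"
    using w L2_01_imp_integrable_mult_ident[OF w] L2_01_imp_integrable[OF w]
    by (auto simp: L2_01_def intro: continuous_imp_integrable_real)
  have "(\<lambda>t. (w t + (a * t + b))\<^sup>2)
      = (\<lambda>t. ((w t)\<^sup>2 + (a * t + b)\<^sup>2) + (2 * a * (t * w t) + 2 * b * w t))"
    by (rule ext) (simp add: power2_eq_square algebra_simps)
  then have "integral\<^sup>L ?M (\<lambda>t. (w t + (a * t + b))\<^sup>2)
      = integral\<^sup>L ?M (\<lambda>t. (w t)\<^sup>2 + (a * t + b)\<^sup>2) + integral\<^sup>L ?M (\<lambda>t. 2 * a * (t * w t) + 2 * b * w t)"
    using int by (simp add: Bochner_Integration.integral_add)
  also have "\<dots> = integral\<^sup>L ?M (\<lambda>t. (w t)\<^sup>2) + integral\<^sup>L ?M (\<lambda>t. (a * t + b)\<^sup>2)"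
    using int w_orth by simp
  finally show ?thesis .
qed

lemma admissible_pythagoras:
  assumes u: "u \<in> admissible s0 sf v0 vf" and p: "p \<in> admissible s0 sf v0 vf"
    and p_eq: "\<And>t. p t = f t + (a * t + b)"
  shows "integral\<^sup>L (lebesgue_on {0..1}) (\<lambda>t. (u t - f t)\<^sup>2)
    = integral\<^sup>L (lebesgue_on {0..1}) (\<lambda>t. (u t - p t)\<^sup>2) + integral\<^sup>L (lebesgue_on {0..1}) (\<lambda>t. (p t - f t)\<^sup>2)"
proof -
  let ?M = "lebesgue_on {0..1::real}"
  have L2: "L2_01 u" "L2_01 p"
    using u p unfolding admissible_def by auto
  have "integral\<^sup>L ?M (\<lambda>t. u t - p t) = 0"
    using admissible_moments(1)[OF u] admissible_moments(1)[OF p] L2_01_imp_integrable[OF L2(1)]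
      L2_01_imp_integrable[OF L2(2)] by simp
  moreover have "integral\<^sup>L ?M (\<lambda>t. t * (u t - p t)) = 0"
    using admissible_moments(2)[OF u] admissible_moments(2)[OF p] L2_01_imp_integrable_mult_ident[OF L2(1)]
      L2_01_imp_integrable_mult_ident[OF L2(2)] by (simp add: right_diff_distrib)
  ultimately have "integral\<^sup>L ?M (\<lambda>t. ((u t - p t) + (a * t + b))\<^sup>2)
      = integral\<^sup>L ?M (\<lambda>t. (u t - p t)\<^sup>2) + integral\<^sup>L ?M (\<lambda>t. (a * t + b)\<^sup>2)"
    by (intro integral_square_add_affine_orthogonal L2_01_diff L2)
  then show ?thesis
    by (simp add: p_eq)
qed

lemma is_L2_projectionI:
  assumes p: "p \<in> A" and L2: "\<And>u. u \<in> A \<Longrightarrow> L2_01 u"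
    and pythagoras: "\<And>u. u \<in> A \<Longrightarrow> integral\<^sup>L (lebesgue_on {0..1}) (\<lambda>t. (u t - f t)\<^sup>2)
      = integral\<^sup>L (lebesgue_on {0..1}) (\<lambda>t. (u t - p t)\<^sup>2) + integral\<^sup>L (lebesgue_on {0..1}) (\<lambda>t. (p t - f t)\<^sup>2)"
  shows "is_L2_projection A f p"
  unfolding is_L2_projection_def
proof (intro conjI ballI impI)
  fix u
  assume "u \<in> A"
  have nonneg: "0 \<le> integral\<^sup>L (lebesgue_on {0..1}) (\<lambda>t. (u t - p t)\<^sup>2)"
    by simp
  then show "1 / 2 * integral\<^sup>L (lebesgue_on {0..1}) (\<lambda>t. (p t - f t)\<^sup>2)
      \<le> 1 / 2 * integral\<^sup>L (lebesgue_on {0..1}) (\<lambda>t. (u t - f t)\<^sup>2)"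
    using pythagoras[OF \<open>u \<in> A\<close>] by simp
  assume "1 / 2 * integral\<^sup>L (lebesgue_on {0..1}) (\<lambda>t. (u t - f t)\<^sup>2)
      \<le> 1 / 2 * integral\<^sup>L (lebesgue_on {0..1}) (\<lambda>t. (p t - f t)\<^sup>2)"
  with nonneg pythagoras[OF \<open>u \<in> A\<close>]
  have "integral\<^sup>L (lebesgue_on {0..1}) (\<lambda>t. (u t - p t)\<^sup>2) = 0"
    by linarith
  moreover have "integrable (lebesgue_on {0..1}) (\<lambda>t. (u t - p t)\<^sup>2)"
    using L2_01_diff[OF L2[OF \<open>u \<in> A\<close>] L2[OF p]] unfolding L2_01_def by simp
  ultimately have "AE t in lebesgue_on {0..1}. (u t - p t)\<^sup>2 = 0"
    by (subst (asm) integral_nonneg_eq_0_iff_AE) auto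
  then show "AE t in lebesgue_on {0..1}. u t = p t"
    by (rule AE_mp) (intro AE_I2; simp)
qed (rule p)

theorem proposition1:
  fixes s0 sf v0 vf :: real
    and um x1 x2 :: "real \<Rightarrow> real"
  assumes "L2_01 um"
    and "W12_01 x1" and "W12_01 x2"
    and "AE t in lebesgue_on {0..1}. (x1 has_real_derivative x2 t) (at t)
                                   \<and> (x2 has_real_derivative um t) (at t)"
    and "x1 0 = s0" and "x2 0 = v0"
  shows "let c1 = 12 * (x1 1 - sf) - 6 * (x2 1 - vf);
             c2 = - 6 * (x1 1 - sf) + 2 * (x2 1 - vf)
         in is_L2_projection (admissible s0 sf v0 vf) um (\<lambda>t. um t + c1 * t + c2)"
proof -
  define c1 where "c1 = 12 * (x1 1 - sf) - 6 * (x2 1 - vf)"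
  define c2 where "c2 = - 6 * (x1 1 - sf) + 2 * (x2 1 - vf)"
  define p where "p = (\<lambda>t. um t + c1 * t + c2)"
  have "x1 1 + c1 / 6 + c2 / 2 = sf" "x2 1 + c1 / 2 + c2 = vf"
    by (simp_all add: c1_def c2_def field_simps)
  then have p_admissible: "p \<in> admissible s0 sf v0 vf"
    using admissible_add_affine[OF assms(1-4), of c1 c2] assms(5,6) by (simp add: p_def)
  have "is_L2_projection (admissible s0 sf v0 vf) um p"
  proof (rule is_L2_projectionI[OF p_admissible])
    show "L2_01 u" if "u \<in> admissible s0 sf v0 vf" for u
      using that by (simp add: admissible_def)
    show "integral\<^sup>L (lebesgue_on {0..1}) (\<lambda>t. (u t - um t)\<^sup>2)
      = integral\<^sup>L (lebesgue_on {0..1}) (\<lambda>t. (u t - p t)\<^sup>2) + integral\<^sup>L (lebesgue_on {0..1}) (\<lambda>t. (p t - um t)\<^sup>2)"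
      if "u \<in> admissible s0 sf v0 vf" for u
      by (rule admissible_pythagoras[OF that p_admissible]) (simp add: p_def)
  qed
  then show ?thesis
    unfolding Let_def c1_def c2_def p_def .
qed

end
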